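(* For every integer $n \geq 10$, $rsat(n,C_7) \leq 2n-2$.
   Context: All graphs are finite, simple and undirected. An edge-coloring of a graph $G$ is a function $\mathcal{C}:E(G)\to\mathbb{N}$; a (sub)graph is rainbow if all its edges have distinct colors. An edge-colored graph $G$ is $F$-rainbow saturated if it contains no rainbow copy of $F$ but adding any nonedge of $G$ with any color on it creates a rainbow copy of $F$. $rsat(n,F)$ is the minimum number of edges of a graph on $n$ vertices admitting an edge-coloring that makes it $F$-rainbow saturated. $C_r$ is the cycle on $r$ vertices. *)

theory Defs
  imports Main "HOL-Library.Extended_Nat"
begin

text \<open>
  A graph is a pair of a vertex set and a set of edges, an edge being the two-element set of
  its end vertices.
\<close>

type_synonym 'a graph = "'a set \<times> 'a set set"

abbreviation verts :: "'a graph \<Rightarrow> 'a set" where "verts \<equiv> fst"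
abbreviation edges :: "'a graph \<Rightarrow> 'a set set" where "edges \<equiv> snd"

definition simple_graph :: "'a graph \<Rightarrow> bool" where
  "simple_graph G \<longleftrightarrow> finite (verts G) \<and> edges G \<subseteq> {e. e \<subseteq> verts G \<and> card e = 2}"

definition nonedges :: "'a graph \<Rightarrow> 'a set set" where
  "nonedges G = {e. e \<subseteq> verts G \<and> card e = 2} - edges G"

definition add_edge :: "'a graph \<Rightarrow> 'a set \<Rightarrow> 'a graph" where
  "add_edge G e = (verts G, insert e (edges G))"

text \<open>
  An edge-coloring is represented by a total function on vertex sets; only its values on the edges
  of the graph at hand are ever used. Colorings need not be proper.
\<close>

type_synonym 'a coloring = "'a set \<Rightarrow> nat"

definition rainbow :: "'a coloring \<Rightarrow> 'a graph \<Rightarrow> bool" where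
  "rainbow c H \<longleftrightarrow> inj_on c (edges H)"

definition subgraph :: "'a graph \<Rightarrow> 'a graph \<Rightarrow> bool" where
  "subgraph H G \<longleftrightarrow> simple_graph H \<and> verts H \<subseteq> verts G \<and> edges H \<subseteq> edges G"

definition graph_iso :: "'a graph \<Rightarrow> 'b graph \<Rightarrow> bool" where
  "graph_iso F H \<longleftrightarrow> (\<exists>f. bij_betw f (verts F) (verts H) \<and> edges H = (\<lambda>e. f ` e) ` edges F)"

text \<open>Copies are subgraphs, not necessarily induced.\<close>

definition has_rainbow_copy :: "'b graph \<Rightarrow> 'a graph \<Rightarrow> 'a coloring \<Rightarrow> bool" where
  "has_rainbow_copy F G c \<longleftrightarrow> (\<exists>H. subgraph H G \<and> graph_iso F H \<and> rainbow c H)"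

definition rainbow_saturated :: "'b graph \<Rightarrow> 'a graph \<Rightarrow> 'a coloring \<Rightarrow> bool" where
  "rainbow_saturated F G c \<longleftrightarrow>
     \<not> has_rainbow_copy F G c \<and>
     (\<forall>e \<in> nonedges G. \<forall>k. has_rainbow_copy F (add_edge G e) (c(e := k)))"

text \<open>
  The minimum is taken in \<^typ>\<open>enat\<close>, so that it is \<open>\<infinity>\<close> if no suitable graph exists; a finite
  upper bound therefore always asserts existence. Taking the vertices to be natural numbers loses
  no generality, since every finite graph is isomorphic to such a graph.
\<close>

definition rsat :: "nat \<Rightarrow> 'b graph \<Rightarrow> enat" where
  "rsat n F = Inf {enat (card (edges G)) | G :: nat graph.
     simple_graph G \<and> card (verts G) = n \<and> (\<exists>c. rainbow_saturated F G c)}"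

text \<open>The cycle on \<open>r\<close> vertices, meant for \<open>r \<ge> 3\<close>.\<close>

definition cycle_graph :: "nat \<Rightarrow> nat graph" where
  "cycle_graph r = ({..<r}, {{i, Suc i mod r} | i. i < r})"

end

theory Submission
  imports Defs "HOL-Library.Nat_Bijection"
begin

text \<open>
  Take a complete graph on \<open>a, b, c, d\<close>, join each vertex of a set \<open>A\<close> to \<open>a\<close> and \<open>b\<close>, join each
  vertex of a set \<open>B\<close> to \<open>c\<close> and \<open>d\<close>, and give all edges different colors. Two vertices of \<open>A\<close> on a
  common cycle close a 4-cycle with \<open>a\<close> and \<open>b\<close>, and likewise for \<open>B\<close>; hence a longer cycle has at
  most 6 vertices, and there is no 7-cycle at all. If \<open>A\<close> and \<open>B\<close> have at least three elements each,
  then every nonedge \<open>e\<close> lies on two 7-cycles of the extended graph that have only \<open>e\<close> in common. At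
  most one edge of the original graph has the color given to \<open>e\<close>, so one of the two is rainbow.
\<close>

section \<open>Rainbow copies of cycles as vertex lists\<close>

definition cycle_edges :: "'a list \<Rightarrow> 'a set set" where
  "cycle_edges xs = {{xs ! i, xs ! (Suc i mod length xs)} | i. i < length xs}"

lemma cycle_edges_7:
  "cycle_edges [p, q, r, s, t, u, v] = {{p,q}, {q,r}, {r,s}, {s,t}, {t,u}, {u,v}, {v,p}}"
proof -
  have "cycle_edges [p, q, r, s, t, u, v] =
    (\<lambda>i. {[p, q, r, s, t, u, v] ! i, [p, q, r, s, t, u, v] ! (Suc i mod 7)}) ` {..<7}"
    by (auto simp: cycle_edges_def)
  also have "{..<7::nat} = {0, 1, 2, 3, 4, 5, 6}"
    by auto
  finally show ?thesis
    by simp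
qed

lemma image_cycle_graph:
  assumes "length xs = r"
  shows "(\<lambda>e. (!) xs ` e) ` edges (cycle_graph r) = cycle_edges xs"
proof -
  have "edges (cycle_graph r) = (\<lambda>i. {i, Suc i mod r}) ` {..<r}"
    by (auto simp: cycle_graph_def)
  moreover have "cycle_edges xs = (\<lambda>i. {xs ! i, xs ! (Suc i mod r)}) ` {..<r}"
    using assms by (auto simp: cycle_edges_def)
  ultimately show ?thesis
    by (simp add: image_image)
qed

text \<open>An isomorphism from \<open>cycle_graph r\<close> amounts to the list of its values at 0,
  ..., r - 1, so copies can be given and refuted as explicit lists.\<close>

lemma has_rainbow_cycle_iff:
  assumes "simple_graph G"
  shows "has_rainbow_copy (cycle_graph r) G c \<longleftrightarrow>
    (\<exists>xs. length xs = r \<and> distinct xs \<and> set xs \<subseteq> verts G \<and> cycle_edges xs \<subseteq> edges G \<and>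
      inj_on c (cycle_edges xs))"
proof
  assume "has_rainbow_copy (cycle_graph r) G c"
  then obtain H f where H: "subgraph H G" "rainbow c H"
    and f: "bij_betw f {..<r} (verts H)" "edges H = (\<lambda>e. f ` e) ` edges (cycle_graph r)"
    unfolding has_rainbow_copy_def graph_iso_def by (auto simp: cycle_graph_def)
  define xs where "xs = map f [0..<r]"
  have "edges H = (\<lambda>e. (!) xs ` e) ` edges (cycle_graph r)"
    unfolding f(2) by (rule image_cong) (auto simp: cycle_graph_def xs_def)
  also have "\<dots> = cycle_edges xs"
    by (rule image_cycle_graph) (simp add: xs_def)
  finally have "edges H = cycle_edges xs" .
  moreover have "distinct xs" "set xs = verts H"
    using f(1) by (auto simp: xs_def distinct_map bij_betw_def atLeast0LessThan)
  ultimately show "\<exists>xs. length xs = r \<and> distinct xs \<and> set xs \<subseteq> verts G \<and>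
      cycle_edges xs \<subseteq> edges G \<and> inj_on c (cycle_edges xs)"
    using H by (intro exI[of _ xs]) (auto simp: subgraph_def rainbow_def xs_def)
next
  assume "\<exists>xs. length xs = r \<and> distinct xs \<and> set xs \<subseteq> verts G \<and> cycle_edges xs \<subseteq> edges G \<and>
      inj_on c (cycle_edges xs)"
  then obtain xs where xs: "length xs = r" "distinct xs" "set xs \<subseteq> verts G"
    "cycle_edges xs \<subseteq> edges G" "inj_on c (cycle_edges xs)"
    by blast
  let ?H = "(set xs, cycle_edges xs)"
  have "e \<subseteq> set xs" if "e \<in> cycle_edges xs" for e
  proof -
    from that obtain i where "i < length xs" "e = {xs ! i, xs ! (Suc i mod length xs)}"
      by (auto simp: cycle_edges_def)
    moreover from this have "Suc i mod length xs < length xs"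
      by (intro mod_less_divisor) auto
    ultimately show ?thesis
      by simp
  qed
  then have "subgraph ?H G"
    using xs assms by (auto simp: subgraph_def simple_graph_def)
  moreover have "graph_iso (cycle_graph r) ?H"
    unfolding graph_iso_def
    using bij_betw_nth[of xs "{..<r}" "set xs"] xs image_cycle_graph[of xs r]
    by (intro exI[of _ "(!) xs"]) (auto simp: cycle_graph_def)
  ultimately show "has_rainbow_copy (cycle_graph r) G c"
    using xs(5) by (auto simp: has_rainbow_copy_def rainbow_def)
qed

lemma rainbow_cycle_add_edge:
  assumes G: "simple_graph G" and c: "inj_on c (edges G)" and e: "e \<in> nonedges G"
    and "length xs = r" "distinct xs" "set xs \<subseteq> verts G" "cycle_edges xs \<subseteq> insert e (edges G)"
    and "length ys = r" "distinct ys" "set ys \<subseteq> verts G" "cycle_edges ys \<subseteq> insert e (edges G)"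
    and disj: "cycle_edges xs \<inter> cycle_edges ys \<subseteq> {e}"
  shows "has_rainbow_copy (cycle_graph r) (add_edge G e) (c(e := k))"
proof -
  have simple: "simple_graph (add_edge G e)"
    using G e by (auto simp: simple_graph_def add_edge_def nonedges_def)
  have *: "has_rainbow_copy (cycle_graph r) (add_edge G e) (c(e := k))"
    if zs: "length zs = r" "distinct zs" "set zs \<subseteq> verts G"
      "cycle_edges zs \<subseteq> insert e (edges G)" and k: "k \<notin> c ` (cycle_edges zs - {e})" for zs
  proof -
    have "inj_on c (cycle_edges zs - {e})"
      using zs(4) by (intro inj_on_subset[OF c]) auto
    then have "inj_on (c(e := k)) (cycle_edges zs)"
      using k unfolding inj_on_def by auto
    then show ?thesis
      unfolding has_rainbow_cycle_iff[OF simple] using zs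
      by (intro exI[of _ zs]) (simp add: add_edge_def)
  qed
  \<comment> \<open>If \<open>k\<close> occurred on both cycles away from \<open>e\<close>,
    injectivity of \<open>c\<close> would make the two edges of that color one common edge other
    than \<open>e\<close>.\<close>
  have "k \<notin> c ` (cycle_edges xs - {e}) \<or> k \<notin> c ` (cycle_edges ys - {e})"
  proof (rule ccontr)
    assume "\<not> ?thesis"
    then obtain f g where "f \<in> cycle_edges xs - {e}" "g \<in> cycle_edges ys - {e}" "c f = c g"
      by auto
    moreover from this have "f = g"
      using assms(7,11) by (intro inj_onD[OF c]) auto
    ultimately show False
      using disj by auto
  qed
  then show ?thesis
    using *[of xs] *[of ys] assms by blast
qed

section \<open>The graph and the absence of 7-cycles\<close>

definition books_graph :: "'a \<Rightarrow> 'a \<Rightarrow> 'a \<Rightarrow> 'a \<Rightarrow> 'a set \<Rightarrow> 'a set \<Rightarrow> 'a graph" where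
  "books_graph a b c d A B = ({a, b, c, d} \<union> A \<union> B,
     {{a,b}, {a,c}, {a,d}, {b,c}, {b,d}, {c,d}} \<union>
     (\<lambda>x. {x, a}) ` A \<union> (\<lambda>x. {x, b}) ` A \<union> (\<lambda>y. {y, c}) ` B \<union> (\<lambda>y. {y, d}) ` B)"

text \<open>This symmetry and the next one reduce nonedges at \<open>d\<close> to those at
  \<open>c\<close>, and nonedges meeting \<open>B\<close> to those meeting \<open>A\<close>.\<close>

lemma books_graph_commute: "books_graph a b d c A B = books_graph a b c d A B"
  by (auto simp: books_graph_def insert_commute)

lemma books_graph_swap: "books_graph c d a b B A = books_graph a b c d A B"
  by (auto simp: books_graph_def insert_commute)

text \<open>A book consists of triangles on a common edge, its spine. Here the spines are
  \<open>{a, b}\<close> and \<open>{c, d}\<close>, and the vertices of \<open>A\<close> and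
  \<open>B\<close> are called pages below.\<close>

locale two_books =
  fixes a b c d :: 'a and A B :: "'a set"
  assumes dist: "distinct [a, b, c, d]"
    and fin: "finite A" "finite B"
    and disjoint: "A \<inter> B = {}" "A \<inter> {a, b, c, d} = {}" "B \<inter> {a, b, c, d} = {}"
begin

abbreviation G :: "'a graph" where "G \<equiv> books_graph a b c d A B"

lemma swap: "two_books c d a b B A"
  by unfold_locales (use dist fin disjoint in auto)

lemma simple_graph: "simple_graph G"
  unfolding simple_graph_def books_graph_def using dist fin disjoint by (auto simp: card_insert_if)

lemma card_verts: "card (verts G) = card A + card B + 4"
proof -
  have "card ({a, b, c, d} \<union> A \<union> B) = card {a, b, c, d} + card A + card B"
    using fin disjoint by (subst card_Un_disjoint; (subst card_Un_disjoint)?) auto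
  then show ?thesis
    using dist by (simp add: books_graph_def)
qed

lemma card_edges_le: "card (edges G) \<le> 2 * card A + 2 * card B + 6"
proof -
  have union: "card (S \<union> T) \<le> s + t" if "card S \<le> s" "card T \<le> t" for S T :: "'a set set" and s t
    using card_Un_le[of S T] that by linarith
  have "card (edges G) \<le> 6 + card A + card A + card B + card B"
    unfolding books_graph_def snd_conv
    by (intro union card_image_le fin) (simp add: card_insert_if)
  then show ?thesis
    by simp
qed

lemma edgesI:
  "{a, b} \<in> edges G" "{a, c} \<in> edges G" "{a, d} \<in> edges G"
  "{b, c} \<in> edges G" "{b, d} \<in> edges G" "{c, d} \<in> edges G"
  "x \<in> A \<Longrightarrow> {x, a} \<in> edges G" "x \<in> A \<Longrightarrow> {a, x} \<in> edges G"
  "x \<in> A \<Longrightarrow> {x, b} \<in> edges G" "x \<in> A \<Longrightarrow> {b, x} \<in> edges G"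
  "y \<in> B \<Longrightarrow> {y, c} \<in> edges G" "y \<in> B \<Longrightarrow> {c, y} \<in> edges G"
  "y \<in> B \<Longrightarrow> {y, d} \<in> edges G" "y \<in> B \<Longrightarrow> {d, y} \<in> edges G"
  by (auto simp: books_graph_def insert_commute)

lemma neighbour: "{x, v} \<in> edges G \<Longrightarrow> x \<in> A \<Longrightarrow> v \<in> {a, b}"
  using dist disjoint by (auto simp: books_graph_def doubleton_eq_iff)

text \<open>A page of \<open>A\<close> has only the neighbours \<open>a\<close> and
  \<open>b\<close>, so on a cycle it sits between them. Two distinct vertices of a 7-cycle never
  have the same pair of cyclic neighbours.\<close>

lemma card_cycle_Int:
  assumes xs: "length xs = 7" "distinct xs" "cycle_edges xs \<subseteq> edges G"
  shows "card (set xs \<inter> A) \<le> 1"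
proof -
  \<comment> \<open>Adding 6 modulo 7 gives the cyclic predecessor without subtraction on
    naturals.\<close>
  have nb: "{xs ! (Suc i mod 7), xs ! ((i + 6) mod 7)} = {a, b}" if i: "i < 7" "xs ! i \<in> A" for i
  proof -
    have "{xs ! i, xs ! (Suc i mod 7)} \<in> cycle_edges xs"
      using i xs(1) by (auto simp: cycle_edges_def)
    moreover have "Suc ((i + 6) mod 7) mod 7 = i" "(i + 6) mod 7 < 7"
      using i by presburger+
    then have "{xs ! i, xs ! ((i + 6) mod 7)} \<in> cycle_edges xs"
      using xs(1) unfolding cycle_edges_def
      by (auto simp: insert_commute intro!: exI[of _ "(i + 6) mod 7"])
    ultimately have "xs ! (Suc i mod 7) \<in> {a, b}" "xs ! ((i + 6) mod 7) \<in> {a, b}"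
      using neighbour[of "xs ! i"] i xs(3) by blast+
    moreover have "Suc i mod 7 \<noteq> (i + 6) mod 7"
      by presburger
    then have "xs ! (Suc i mod 7) \<noteq> xs ! ((i + 6) mod 7)"
      using xs(1,2) by (simp add: nth_eq_iff_index_eq)
    ultimately show ?thesis
      by auto
  qed
  have "x = y" if x: "x \<in> set xs \<inter> A" and y: "y \<in> set xs \<inter> A" for x y
  proof -
    obtain i j where ij: "i < 7" "j < 7" "x = xs ! i" "y = xs ! j"
      using x y xs(1) by (metis IntD1 in_set_conv_nth)
    have "{xs ! (Suc i mod 7), xs ! ((i + 6) mod 7)} = {xs ! (Suc j mod 7), xs ! ((j + 6) mod 7)}"
      using nb[of i] nb[of j] ij x y by simp
    \<comment> \<open>The pairs agree in order, whence i = j, or crosswise; then j - i would be both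
      2 and -2 modulo 7, which is impossible.\<close>
    then have "Suc i mod 7 = Suc j mod 7 \<or>
        Suc i mod 7 = (j + 6) mod 7 \<and> (i + 6) mod 7 = Suc j mod 7"
      using xs(1,2) by (auto simp: doubleton_eq_iff nth_eq_iff_index_eq)
    moreover have "Suc k mod 7 = (if k = 6 then 0 else Suc k)"
      "(k + 6) mod 7 = (if k = 0 then 6 else k - 1)" if "k < 7" for k :: nat
      using that by (auto simp: mod_if)
    ultimately have "i = j"
      using ij(1,2) by (simp split: if_splits) linarith+
    then show ?thesis
      using ij by simp
  qed
  then show ?thesis
    by (simp add: card_le_Suc0_iff_eq)
qed

lemma no_cycle:
  assumes "length xs = 7" "distinct xs" "set xs \<subseteq> verts G"
  shows "\<not> cycle_edges xs \<subseteq> edges G"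
proof
  assume E: "cycle_edges xs \<subseteq> edges G"
  have "set xs \<subseteq> {a, b, c, d} \<union> (set xs \<inter> A) \<union> (set xs \<inter> B)"
    using assms(3) by (auto simp: books_graph_def)
  then have "card (set xs) \<le> card ({a, b, c, d} \<union> (set xs \<inter> A) \<union> (set xs \<inter> B))"
    by (intro card_mono) auto
  also have "\<dots> \<le> card {a, b, c, d} + card (set xs \<inter> A) + card (set xs \<inter> B)"
    by (intro card_Un_le[THEN order_trans] add_mono card_Un_le order_refl)
  \<comment> \<open>The bound for \<open>B\<close> is the one for \<open>A\<close> after exchanging
    the two books.\<close>
  also have "\<dots> \<le> 4 + 1 + 1"
    using card_cycle_Int[of xs] two_books.card_cycle_Int[OF swap, of xs] assms E dist
    by (intro add_mono) (auto simp: books_graph_swap)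
  finally show False
    using assms(1,2) by (simp add: distinct_card)
qed

end

section \<open>Two 7-cycles through each nonedge\<close>

lemma obtain_third:
  assumes "card S \<ge> 3"
  obtains z where "z \<in> S" "z \<noteq> x" "z \<noteq> y"
proof -
  have "\<not> S \<subseteq> {x, y}"
    using assms card_mono[of "{x, y}" S] card_insert_le_m1[of 2 "{y}" x] by auto
  then show ?thesis
    using that by blast
qed

text \<open>Three pages are what \<open>nonedge_Ac\<close> takes from \<open>A\<close>; by symmetry
  \<open>B\<close> must supply as many. Together with the four spine vertices this accounts for n >=
  10.\<close>

locale large_two_books = two_books +
  assumes large: "card A \<ge> 3" "card B \<ge> 3"
begin

lemma large_swap: "large_two_books c d a b B A"
  using swap large by (simp add: large_two_books_def large_two_books_axioms_def)

lemma large_commute: "large_two_books a b d c A B"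
  by unfold_locales (use dist fin disjoint large in auto)

text \<open>Exchanging \<open>a\<close> with \<open>b\<close> and replacing \<open>y\<close> by
  \<open>y'\<close> turns the first cycle into the second; only the new edge survives in
  both.\<close>

lemma nonedge_AA:
  assumes col: "inj_on col (edges G)" and e: "{x, x'} \<in> nonedges G" and x: "x \<in> A" "x' \<in> A"
  shows "has_rainbow_copy (cycle_graph 7) (add_edge G {x, x'}) (col({x, x'} := k))"
proof -
  have "x \<noteq> x'"
    using e by (auto simp: nonedges_def)
  obtain y where y: "y \<in> B"
    using obtain_third[OF large(2)] by blast
  obtain y' where y': "y' \<in> B" "y' \<noteq> y"
    using obtain_third[OF large(2)] by blast
  \<comment> \<open>The reversed list supplies each inequality in the opposite orientation, so that
    doubletons can be told apart whichever vertex is written first.\<close>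
  have "distinct [a, b, c, d, x, x', y, y']" "distinct [y', y, x', x, d, c, b, a]"
    using dist disjoint x y y' \<open>x \<noteq> x'\<close> by auto
  moreover have "cycle_edges [x, a, c, y, d, b, x'] \<subseteq> insert {x, x'} (edges G)"
    "cycle_edges [x, b, c, y', d, a, x'] \<subseteq> insert {x, x'} (edges G)"
    using x y y' \<open>x \<noteq> x'\<close> by (simp_all add: cycle_edges_7 insert_commute edgesI)
  moreover have "set [a, b, c, d, x, x', y, y'] \<subseteq> verts G"
    using x y y' \<open>x \<noteq> x'\<close> by (auto simp: books_graph_def)
  ultimately show ?thesis
    by (intro rainbow_cycle_add_edge[OF simple_graph col e,
          where xs = "[x, a, c, y, d, b, x']" and ys = "[x, b, c, y', d, a, x']"])
      (simp_all add: cycle_edges_7 doubleton_eq_iff)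
qed

text \<open>One cycle detours through the page \<open>y'\<close> and uses the spine
  \<open>{a, b}\<close>, the other detours through \<open>x'\<close> and uses the spine
  \<open>{c, d}\<close>. They pass between the spines by \<open>{d, a}\<close> and
  \<open>{c, b}\<close> respectively.\<close>

lemma nonedge_AB:
  assumes col: "inj_on col (edges G)" and e: "{x, y} \<in> nonedges G" and x: "x \<in> A" and y: "y \<in> B"
  shows "has_rainbow_copy (cycle_graph 7) (add_edge G {x, y}) (col({x, y} := k))"
proof -
  obtain x' where x': "x' \<in> A" "x' \<noteq> x"
    using obtain_third[OF large(1)] by blast
  obtain y' where y': "y' \<in> B" "y' \<noteq> y"
    using obtain_third[OF large(2)] by blast
  have "distinct [a, b, c, d, x, x', y, y']" "distinct [y', y, x', x, d, c, b, a]"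
    using dist disjoint x y x' y' by auto
  moreover have "cycle_edges [y, c, y', d, a, b, x] \<subseteq> insert {x, y} (edges G)"
    "cycle_edges [y, d, c, b, x', a, x] \<subseteq> insert {x, y} (edges G)"
    using x y x' y' by (simp_all add: cycle_edges_7 insert_commute edgesI)
  moreover have "set [a, b, c, d, x, x', y, y'] \<subseteq> verts G"
    using x y x' y' by (auto simp: books_graph_def)
  ultimately show ?thesis
    by (intro rainbow_cycle_add_edge[OF simple_graph col e,
          where xs = "[y, c, y', d, a, b, x]" and ys = "[y, d, c, b, x', a, x]"])
      (simp_all add: cycle_edges_7 doubleton_eq_iff)
qed

text \<open>Again \<open>a\<close> and \<open>b\<close> are exchanged between the cycles. Each
  visits a second page of \<open>A\<close>, and these must differ, hence \<open>x'\<close> and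
  \<open>x''\<close>.\<close>

lemma nonedge_Ac:
  assumes col: "inj_on col (edges G)" and e: "{x, c} \<in> nonedges G" and x: "x \<in> A"
  shows "has_rainbow_copy (cycle_graph 7) (add_edge G {x, c}) (col({x, c} := k))"
proof -
  obtain x' where x': "x' \<in> A" "x' \<noteq> x"
    using obtain_third[OF large(1)] by blast
  obtain x'' where x'': "x'' \<in> A" "x'' \<noteq> x" "x'' \<noteq> x'"
    using obtain_third[OF large(1)] by blast
  obtain y where y: "y \<in> B"
    using obtain_third[OF large(2)] by blast
  obtain y' where y': "y' \<in> B" "y' \<noteq> y"
    using obtain_third[OF large(2)] by blast
  have "distinct [a, b, c, d, x, x', x'', y, y']" "distinct [y', y, x'', x', x, d, c, b, a]"
    using dist disjoint x y x' x'' y' by auto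
  moreover have "cycle_edges [c, y, d, a, x', b, x] \<subseteq> insert {x, c} (edges G)"
    "cycle_edges [c, y', d, b, x'', a, x] \<subseteq> insert {x, c} (edges G)"
    using x y x' x'' y' by (simp_all add: cycle_edges_7 insert_commute edgesI)
  moreover have "set [a, b, c, d, x, x', x'', y, y'] \<subseteq> verts G"
    using x y x' x'' y' by (auto simp: books_graph_def)
  ultimately show ?thesis
    by (intro rainbow_cycle_add_edge[OF simple_graph col e,
          where xs = "[c, y, d, a, x', b, x]" and ys = "[c, y', d, b, x'', a, x]"])
      (simp_all add: cycle_edges_7 doubleton_eq_iff)
qed

lemma nonedge_A:
  assumes col: "inj_on col (edges G)" and e: "e \<in> nonedges G" and "e \<inter> A \<noteq> {}"
  shows "has_rainbow_copy (cycle_graph 7) (add_edge G e) (col(e := k))"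
proof -
  have "card e = 2" "e \<subseteq> verts G" "e \<notin> edges G"
    using e by (auto simp: nonedges_def)
  then obtain x v where v: "e = {x, v}" "x \<in> A"
    using assms(3) by (auto simp: card_2_iff insert_commute)
  have "v \<in> {a, b, c, d} \<union> A \<union> B"
    using \<open>e \<subseteq> verts G\<close> v by (simp add: books_graph_def)
  moreover have "v \<noteq> a" "v \<noteq> b"
    using \<open>e \<notin> edges G\<close> v edgesI by auto
  ultimately consider "v \<in> A" | "v \<in> B" | "v = c" | "v = d"
    by blast
  then show ?thesis
  proof cases
    case 1
    then show ?thesis
      using nonedge_AA[OF col] e v by simp
  next
    case 2
    then show ?thesis
      using nonedge_AB[OF col] e v by simp
  next
    case 3
    then show ?thesis
      using nonedge_Ac[OF col] e v by simp
  next
    case 4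
    then show ?thesis
      using large_two_books.nonedge_Ac[OF large_commute,
          unfolded books_graph_commute[of a b d c], OF col] e v
      by simp
  qed
qed

lemma rainbow_saturated:
  assumes col: "inj_on col (edges G)"
  shows "rainbow_saturated (cycle_graph 7) G col"
  unfolding rainbow_saturated_def
proof (intro conjI ballI allI)
  show "\<not> has_rainbow_copy (cycle_graph 7) G col"
    using no_cycle by (auto simp: has_rainbow_cycle_iff[OF simple_graph])
next
  fix e k
  assume e: "e \<in> nonedges G"
  then have "card e = 2" "e \<subseteq> verts G" "e \<notin> edges G"
    by (auto simp: nonedges_def)
  \<comment> \<open>A pair without a page lies inside the complete graph on the four spine vertices,
    so it is already an edge.\<close>
  have "e \<inter> A \<noteq> {} \<or> e \<inter> B \<noteq> {}"
  proof (rule ccontr)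
    assume "\<not> ?thesis"
    then have "e \<subseteq> {a, b, c, d}"
      using \<open>e \<subseteq> verts G\<close> unfolding books_graph_def fst_conv by blast
    with \<open>card e = 2\<close> obtain u v where
      "e = {u, v}" "u \<noteq> v" "u \<in> {a, b, c, d}" "v \<in> {a, b, c, d}"
      unfolding card_2_iff by blast
    then show False
      using \<open>e \<notin> edges G\<close> edgesI(1-6) by (auto simp: insert_commute)
  qed
  then show "has_rainbow_copy (cycle_graph 7) (add_edge G e) (col(e := k))"
    using nonedge_A[OF col e]
      large_two_books.nonedge_A[OF large_swap, unfolded books_graph_swap[of c d], OF col e]
    by blast
qed

end

theorem theorem1p5:
  fixes n :: nat
  assumes "n \<ge> 10"
  shows "rsat n (cycle_graph 7) \<le> enat (2 * n - 2)"
proof -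
  \<comment> \<open>\<open>A\<close> gets exactly three pages and \<open>B\<close> the other n - 7,
    which are at least three.\<close>
  interpret large_two_books 0 1 2 3 "{4..<7}" "{7..<n}"
    by unfold_locales (use assms in auto)
  have fin: "finite e" if "e \<in> edges G" for e
    using that simple_graph by (auto simp: simple_graph_def intro: finite_subset)
  \<comment> \<open>Edges are finite sets of naturals, so their binary encoding colors them all
    differently.\<close>
  have "inj_on set_encode (edges G)"
    by (rule inj_on_subset[OF inj_on_set_encode]) (use fin in auto)
  then have "rainbow_saturated (cycle_graph 7) G set_encode"
    by (rule rainbow_saturated)
  moreover have "card (verts G) = n"
    using card_verts assms by simp
  ultimately have "rsat n (cycle_graph 7) \<le> enat (card (edges G))"
    unfolding rsat_def using simple_graph by (intro Inf_lower) blast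
  \<comment> \<open>There are n - 4 pages with two edges each, and 2 * (n - 4) + 6 = 2 * n -
    2.\<close>
  also have "card (edges G) \<le> 2 * n - 2"
    using card_edges_le assms by simp
  finally show ?thesis
    by simp
qed

end
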